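(* Let $\mathcal H_1=\mathcal H_1(\Omega_1)$ and $\mathcal H_2=\mathcal H_2(\Omega_2)$ be functional Hilbert spaces, let $S\in\mathcal B(\mathcal H_1)$, $X\in\mathcal B(\mathcal H_2,\mathcal H_1)$, $Y\in\mathcal B(\mathcal H_1,\mathcal H_2)$, $R\in\mathcal B(\mathcal H_2)$, and let $T=\begin{bmatrix}S&X\\ Y&R\end{bmatrix}\in\mathcal B(\mathcal H_1\oplus\mathcal H_2)$. Then for every $0\le\alpha\le1$, $$\mathbf{ber}(T)\le \tfrac12\mathbf{ber}(R)+\mathbf{ber}(S)+\tfrac12\sqrt{\alpha^2\,\mathbf{ber}^2(R)+\|Y\|^2}+\tfrac12\sqrt{(1-\alpha)^2\,\mathbf{ber}^2(R)+\|X\|^2}.$$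
   Context: A functional Hilbert space $\mathcal H=\mathcal H(\Omega)$ is a Hilbert space of complex valued functions on a nonempty set $\Omega$ such that for each $\lambda\in\Omega$ the evaluation $h\mapsto h(\lambda)$ is a continuous linear functional on $\mathcal H$; $k_\lambda\in\mathcal H$ denotes the unique element with $h(\lambda)=\langle h,k_\lambda\rangle$ for all $h\in\mathcal H$ (the reproducing kernel, tacitly nonzero for every $\lambda$), and $\hat k_\lambda=k_\lambda/\|k_\lambda\|$. For a bounded operator $A$ on $\mathcal H$, the Berezin symbol is $\widetilde A(\lambda)=\langle A\hat k_\lambda,\hat k_\lambda\rangle$ and the Berezin number is $\mathbf{ber}(A)=\sup\{|\widetilde A(\lambda)|:\lambda\in\Omega\}$; $\mathbf{ber}^{2}(A)=(\mathbf{ber}(A))^2$. On $\mathcal H_1(\Omega_1)\oplus\mathcal H_2(\Omega_2)$ the kernels are indexed by $(\lambda_1,\lambda_2)\in\Omega_1\times\Omega_2$: $k_{(\lambda_1,\lambda_2)}=(k_{\lambda_1},k_{\lambda_2})$, with normalization $\hat k_{(\lambda_1,\lambda_2)}=(k_{\lambda_1},k_{\lambda_2})/\sqrt{\|k_{\lambda_1}\|^2+\|k_{\lambda_2}\|^2}$, and for a bounded operator $T$ on the direct sum $\mathbf{ber}(T)=\sup_{(\lambda_1,\lambda_2)}|\langle T\hat k_{(\lambda_1,\lambda_2)},\hat k_{(\lambda_1,\lambda_2)}\rangle|$. $\mathcal B(\mathcal H,\mathcal K)$ is the space of bounded linear operators from $\mathcal H$ to $\mathcal K$, $\mathcal B(\mathcal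 H)=\mathcal B(\mathcal H,\mathcal H)$, and $\|\cdot\|$ is the operator norm. *)

theory Defs
  imports "HOL-Analysis.Analysis"
begin

class scaleC =
  fixes scaleC :: "complex \<Rightarrow> 'a \<Rightarrow> 'a"  (infixr "*\<^sub>C" 75)

class complex_vector = real_vector + scaleC +
  assumes scaleC_add_right: "a *\<^sub>C (x + y) = a *\<^sub>C x + a *\<^sub>C y"
    and scaleC_add_left: "(a + b) *\<^sub>C x = a *\<^sub>C x + b *\<^sub>C x"
    and scaleC_scaleC: "a *\<^sub>C b *\<^sub>C x = (a * b) *\<^sub>C x"
    and scaleC_one: "1 *\<^sub>C x = x"
    and scaleR_scaleC: "r *\<^sub>R x = complex_of_real r *\<^sub>C x"

text \<open>The inner product is linear in its first argument and conjugate linear in the second.\<close>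

class complex_inner = real_normed_vector + complex_vector +
  fixes cinner :: "'a \<Rightarrow> 'a \<Rightarrow> complex"
  assumes cinner_commute: "cinner x y = cnj (cinner y x)"
    and cinner_add_left: "cinner (x + y) z = cinner x z + cinner y z"
    and cinner_scaleC_left: "cinner (a *\<^sub>C x) y = a * cinner x y"
    and cinner_self_nonneg: "0 \<le> Re (cinner x x)"
    and cinner_self_eq_zero_iff: "cinner x x = 0 \<longleftrightarrow> x = 0"
    and norm_eq_sqrt_cinner: "norm x = sqrt (Re (cinner x x))"

class complex_hilbert_space = complex_inner + complete_space

text \<open>The Hilbert space direct sum is the product type; the library norm on pairs is
  already \<open>sqrt ((norm x)\<^sup>2 + (norm y)\<^sup>2)\<close>.\<close>

instantiation prod :: (complex_vector, complex_vector) complex_vector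
begin

definition scaleC_prod_def: "a *\<^sub>C p = (a *\<^sub>C fst p, a *\<^sub>C snd p)"

instance
  by standard
    (simp_all add: scaleC_prod_def scaleC_add_right scaleC_add_left scaleC_scaleC scaleC_one
      scaleR_prod_def scaleR_scaleC)

end

instantiation prod :: (complex_inner, complex_inner) complex_inner
begin

definition cinner_prod_def: "cinner p q = cinner (fst p) (fst q) + cinner (snd p) (snd q)"

instance
proof
  fix x y z :: "'a \<times> 'b" and a :: complex
  show "cinner x y = cnj (cinner y x)"
    by (metis cinner_prod_def cinner_commute complex_cnj_add)
  show "cinner (x + y) z = cinner x z + cinner y z"
    by (simp add: cinner_prod_def cinner_add_left)
  show "cinner (a *\<^sub>C x) y = a * cinner x y"
    by (simp add: cinner_prod_def scaleC_prod_def cinner_scaleC_left distrib_left)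
  show "0 \<le> Re (cinner x x)"
    by (simp add: cinner_prod_def cinner_self_nonneg)
  have norm_sq: "(norm u)\<^sup>2 = Re (cinner u u)" for u :: "'c::complex_inner"
    by (simp add: norm_eq_sqrt_cinner cinner_self_nonneg)
  show norm_eq: "norm x = sqrt (Re (cinner x x))"
    by (simp add: norm_prod_def cinner_prod_def norm_sq)
  show "cinner x x = 0 \<longleftrightarrow> x = 0"
  proof
    assume "cinner x x = 0"
    then have "norm x = 0" by (simp add: norm_eq)
    then show "x = 0" by simp
  next
    assume "x = 0"
    then show "cinner x x = 0"
      by (simp add: cinner_prod_def cinner_self_eq_zero_iff [THEN iffD2])
  qed
qed

end

instance prod :: (complex_hilbert_space, complex_hilbert_space) complex_hilbert_space ..

definition bounded_clinear :: "('h::complex_inner \<Rightarrow> 'k::complex_inner) \<Rightarrow> bool" where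
  "bounded_clinear A \<longleftrightarrow> bounded_linear A \<and> (\<forall>c x. A (c *\<^sub>C x) = c *\<^sub>C A x)"

definition block_operator ::
  "('h \<Rightarrow> 'h) \<Rightarrow> ('k \<Rightarrow> 'h) \<Rightarrow> ('h \<Rightarrow> 'k) \<Rightarrow> ('k \<Rightarrow> 'k) \<Rightarrow> 'h::plus \<times> 'k::plus \<Rightarrow> 'h \<times> 'k" where
  "block_operator S X Y R = (\<lambda>(f, g). (S f + X g, Y f + R g))"

text \<open>Here and below, \<open>ev h l\<close> is the value \<open>h(l)\<close> of \<open>h\<close> at the point \<open>l\<close>.\<close>

definition reproducing_kernel :: "('h::complex_inner \<Rightarrow> 'o \<Rightarrow> complex) \<Rightarrow> 'o \<Rightarrow> 'h" where
  "reproducing_kernel ev l = (THE k. \<forall>h. ev h l = cinner h k)"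

text \<open>A Hilbert space of functions on \<open>\<Omega>\<close> is rendered as a Hilbert space \<open>'h\<close> whose elements are
  identified with functions on \<open>\<Omega>\<close>: vector space operations are pointwise and an element is
  determined by its values on \<open>\<Omega>\<close>. Values of \<open>ev h\<close> outside \<open>\<Omega>\<close> are irrelevant.
  Existence and uniqueness of the reproducing kernel is a consequence (Riesz), not an assumption;
  only its being nonzero is assumed.\<close>

locale functional_hilbert_space =
  fixes \<Omega> :: "'o set" and ev :: "'h::complex_hilbert_space \<Rightarrow> 'o \<Rightarrow> complex"
  assumes nonempty: "\<Omega> \<noteq> {}"
    and ev_add: "l \<in> \<Omega> \<Longrightarrow> ev (f + g) l = ev f l + ev g l"
    and ev_scaleC: "l \<in> \<Omega> \<Longrightarrow> ev (c *\<^sub>C f) l = c * ev f l"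
    and ev_inject: "(\<And>l. l \<in> \<Omega> \<Longrightarrow> ev f l = ev g l) \<Longrightarrow> f = g"
    and ev_continuous: "l \<in> \<Omega> \<Longrightarrow> continuous_on UNIV (\<lambda>h. ev h l)"
    and kernel_nonzero: "l \<in> \<Omega> \<Longrightarrow> reproducing_kernel ev l \<noteq> 0"

text \<open>Berezin symbol and number with respect to a family of kernels \<open>k\<close> indexed by \<open>\<Omega>\<close>. For a
  functional Hilbert space, \<open>k\<close> is \<open>reproducing_kernel ev\<close>; for a direct sum it is
  \<open>direct_sum_kernel\<close> of the two, indexed by \<open>\<Omega>1 \<times> \<Omega>2\<close>.\<close>

definition normalized_kernel :: "('i \<Rightarrow> 'h::complex_inner) \<Rightarrow> 'i \<Rightarrow> 'h" where
  "normalized_kernel k l = k l /\<^sub>R norm (k l)"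

definition berezin_symbol :: "('i \<Rightarrow> 'h::complex_inner) \<Rightarrow> ('h \<Rightarrow> 'h) \<Rightarrow> 'i \<Rightarrow> complex" where
  "berezin_symbol k A l = cinner (A (normalized_kernel k l)) (normalized_kernel k l)"

definition ber :: "'i set \<Rightarrow> ('i \<Rightarrow> 'h::complex_inner) \<Rightarrow> ('h \<Rightarrow> 'h) \<Rightarrow> real" where
  "ber \<Omega> k A = (SUP l\<in>\<Omega>. cmod (berezin_symbol k A l))"

definition direct_sum_kernel :: "('i \<Rightarrow> 'h) \<Rightarrow> ('j \<Rightarrow> 'k) \<Rightarrow> 'i \<times> 'j \<Rightarrow> 'h \<times> 'k" where
  "direct_sum_kernel k1 k2 = (\<lambda>(l1, l2). (k1 l1, k2 l2))"

end

(* For u = (c k, s l) with unit kernels k, l and c^2 + s^2 = 1, the Berezin symbol of T is at most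
   c^2 ber S + s^2 ber R + c s (norm X + norm Y). Writing
   s^2 = 1/2 + (s^2 - c^2)/2 and splitting (s^2 - c^2) ber R in the proportion alpha : (1 - alpha),
   the estimate is Cauchy-Schwarz against the unit vector (s^2 - c^2, 2 c s), applied to
   (alpha ber R, norm Y) and to ((1 - alpha) ber R, norm X). *)

theory Submission imports Defs begin

lemma cinner_add_right: "cinner x (y + z) = cinner x y + cinner x z"
  by (metis cinner_commute cinner_add_left complex_cnj_add)

lemma cinner_scaleC_right: "cinner x (a *\<^sub>C y) = cnj a * cinner x y"
  by (metis cinner_commute cinner_scaleC_left complex_cnj_mult)

lemma cinner_scaleR_left: "cinner (r *\<^sub>R x) y = of_real r * cinner x y"
  by (simp add: scaleR_scaleC cinner_scaleC_left)

lemma cinner_scaleR_right: "cinner x (r *\<^sub>R y) = of_real r * cinner x y"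
  by (simp add: scaleR_scaleC cinner_scaleC_right)

lemma power2_norm_eq_cinner: "(norm x)\<^sup>2 = Re (cinner x x)"
  by (simp add: norm_eq_sqrt_cinner cinner_self_nonneg)

text \<open>The type class gives homogeneity of the norm for real scalars only; the complex case
  comes from the inner product, where the scalar leaves as \<open>a * cnj a\<close>.\<close>

lemma norm_scaleC: "norm (a *\<^sub>C x) = cmod a * norm (x::'a::complex_inner)"
proof -
  have "cinner (a *\<^sub>C x) (a *\<^sub>C x) = (a * cnj a) * cinner x x"
    by (simp add: cinner_scaleC_left cinner_scaleC_right)
  then have "(norm (a *\<^sub>C x))\<^sup>2 = (cmod a)\<^sup>2 * (norm x)\<^sup>2"
    unfolding power2_norm_eq_cinner complex_norm_square[symmetric] by simp
  then have "(norm (a *\<^sub>C x))\<^sup>2 = (cmod a * norm x)\<^sup>2"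
    by (simp add: power_mult_distrib)
  then show ?thesis
    by (rule power2_eq_imp_eq) simp_all
qed

text \<open>The triangle inequality is part of the normed space structure, so squaring it and
  cancelling the squared norms leaves exactly this half of Cauchy-Schwarz.\<close>

lemma Re_cinner_le_norm: "Re (cinner x y) \<le> norm x * norm (y::'a::complex_inner)"
proof -
  have "(norm (x + y))\<^sup>2 \<le> (norm x + norm y)\<^sup>2"
    by (intro power_mono norm_triangle_ineq) simp
  moreover have "(norm (x + y))\<^sup>2 = (norm x)\<^sup>2 + (norm y)\<^sup>2 + 2 * Re (cinner x y)"
    using arg_cong[OF cinner_commute[of y x], of Re]
    by (simp add: power2_norm_eq_cinner cinner_add_left cinner_add_right)
  ultimately show ?thesis
    by (simp add: power2_sum)
qed

(* Rotating x by a unimodular scalar reduces Cauchy-Schwarz to its real part. *)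
lemma cmod_cinner_le_norm: "cmod (cinner x y) \<le> norm x * norm (y::'a::complex_inner)"
proof (cases "cinner x y = 0")
  case False
  define z where "z = cinner x y"
  define u where "u = cnj z / of_real (cmod z)"
  have z: "cmod z \<noteq> 0" using False by (simp add: z_def)
  have "cmod u = 1" using z by (simp add: u_def norm_divide)
  moreover have "u * z = of_real (cmod z)"
    using z complex_norm_square[of z] by (simp add: u_def field_simps power2_eq_square)
  ultimately show ?thesis
    using Re_cinner_le_norm[of "u *\<^sub>C x" y]
    by (simp add: norm_scaleC cinner_scaleC_left z_def)
qed simp

text \<open>Two different unit vectors are allowed because this serves twice: it bounds Berezin
  symbols, and it bounds the off-diagonal entries of the block operator, which pair kernels of
  different spaces.\<close>

lemma cmod_cinner_unit_le_onorm:
  assumes "bounded_linear A" "norm x = 1" "norm y = 1"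
  shows "cmod (cinner (A x) y) \<le> onorm A"
  using cmod_cinner_le_norm[of "A x" y] onorm[OF assms(1), of x] assms(2,3) by simp

lemma norm_normalized_kernel: "k l \<noteq> 0 \<Longrightarrow> norm (normalized_kernel k l) = 1"
  by (simp add: normalized_kernel_def)

text \<open>A real supremum is an upper bound only for a set bounded above; \<open>onorm A\<close>
  provides that bound.\<close>

lemma cmod_berezin_symbol_le_ber:
  assumes "bounded_linear A" "\<And>l. l \<in> \<Omega> \<Longrightarrow> k l \<noteq> 0" "l \<in> \<Omega>"
  shows "cmod (berezin_symbol k A l) \<le> ber \<Omega> k A"
  unfolding ber_def
proof (rule cSUP_upper[OF assms(3)])
  show "bdd_above ((\<lambda>l. cmod (berezin_symbol k A l)) ` \<Omega>)"
    by (rule bdd_aboveI2[where M = "onorm A"])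
      (simp add: berezin_symbol_def cmod_cinner_unit_le_onorm norm_normalized_kernel assms)
qed

text \<open>The weights are the norms of the two kernels divided by the norm of the pair, that is,
  the cosine and sine of an angle in the first quadrant.\<close>

lemma normalized_kernel_direct_sum:
  assumes "k1 l1 \<noteq> 0" "k2 l2 \<noteq> 0"
  obtains c s where "0 \<le> c" "0 \<le> s" "c\<^sup>2 + s\<^sup>2 = 1"
    "normalized_kernel (direct_sum_kernel k1 k2) (l1, l2)
      = (c *\<^sub>R normalized_kernel k1 l1, s *\<^sub>R normalized_kernel k2 l2)"
proof
  let ?N = "norm (k1 l1, k2 l2)"
  have N: "?N\<^sup>2 = (norm (k1 l1))\<^sup>2 + (norm (k2 l2))\<^sup>2"
    by (simp add: norm_Pair)
  have "?N \<noteq> 0" using assms by (simp add: prod_eq_iff)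
  then show "(norm (k1 l1) / ?N)\<^sup>2 + (norm (k2 l2) / ?N)\<^sup>2 = 1"
    by (simp only: power_divide add_divide_distrib[symmetric] N[symmetric]) simp
  show "normalized_kernel (direct_sum_kernel k1 k2) (l1, l2)
      = ((norm (k1 l1) / ?N) *\<^sub>R normalized_kernel k1 l1,
         (norm (k2 l2) / ?N) *\<^sub>R normalized_kernel k2 l2)"
    using assms by (simp add: normalized_kernel_def direct_sum_kernel_def field_simps)
qed simp_all

lemma cinner_block_operator:
  assumes "bounded_linear S" "bounded_linear X" "bounded_linear Y" "bounded_linear R"
  shows "cinner (block_operator S X Y R (c *\<^sub>R u, s *\<^sub>R v)) (c *\<^sub>R u, s *\<^sub>R v)
    = of_real (c\<^sup>2) * cinner (S u) u + of_real (s\<^sup>2) * cinner (R v) v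
      + of_real (c * s) * (cinner (X v) u + cinner (Y u) v)"
proof -
  note [simp] = assms[THEN bounded_linear.linear, THEN linear_scale]
  show ?thesis
    by (simp add: block_operator_def cinner_prod_def cinner_add_left cinner_scaleR_left
        cinner_scaleR_right power2_eq_square algebra_simps)
qed

lemma cauchy_schwarz_2:
  fixes p q x y :: real
  assumes "p\<^sup>2 + q\<^sup>2 = 1"
  shows "p * x + q * y \<le> sqrt (x\<^sup>2 + y\<^sup>2)"
proof (rule real_le_rsqrt)
  \<comment> \<open>Lagrange's identity: the second square on the left is what the inequality gives
    away.\<close>
  have "(p * x + q * y)\<^sup>2 + (p * y - q * x)\<^sup>2 = (p\<^sup>2 + q\<^sup>2) * (x\<^sup>2 + y\<^sup>2)"
    by (simp add: power2_eq_square algebra_simps)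
  then show "(p * x + q * y)\<^sup>2 \<le> x\<^sup>2 + y\<^sup>2"
    unfolding assms mult_1 by (metis le_add_same_cancel1 zero_le_power2)
qed

lemma weighted_sum_le_sqrt:
  fixes c s r x y \<alpha> :: real
  assumes "c\<^sup>2 + s\<^sup>2 = 1"
  shows "s\<^sup>2 * r + c * s * (x + y)
    \<le> 1/2 * r + 1/2 * sqrt (\<alpha>\<^sup>2 * r\<^sup>2 + y\<^sup>2) + 1/2 * sqrt ((1 - \<alpha>)\<^sup>2 * r\<^sup>2 + x\<^sup>2)"
proof -
  \<comment> \<open>For c = cos t and s = sin t these are -cos 2t and sin 2t, so
    \<open>(p, q)\<close> is again a unit vector, and s squared is given by the half-angle
    formula.\<close>
  define p where "p = s\<^sup>2 - c\<^sup>2"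
  define q where "q = 2 * c * s"
  have "p\<^sup>2 + q\<^sup>2 = (c\<^sup>2 + s\<^sup>2)\<^sup>2"
    by (simp add: p_def q_def power2_eq_square algebra_simps)
  with assms have pq: "p\<^sup>2 + q\<^sup>2 = 1" by simp
  have s: "s\<^sup>2 = 1/2 + p/2" unfolding p_def using assms by argo
  have "s\<^sup>2 * r + c * s * (x + y)
      = 1/2 * r + 1/2 * (p * (\<alpha> * r) + q * y) + 1/2 * (p * ((1 - \<alpha>) * r) + q * x)"
    unfolding s q_def by (simp add: field_simps)
  also have "\<dots> \<le> 1/2 * r + 1/2 * sqrt ((\<alpha> * r)\<^sup>2 + y\<^sup>2) + 1/2 * sqrt (((1 - \<alpha>) * r)\<^sup>2 + x\<^sup>2)"
    by (intro add_mono mult_left_mono cauchy_schwarz_2 pq) simp_all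
  finally show ?thesis by (simp add: power_mult_distrib)
qed

theorem theorem3p7:
  fixes \<Omega>1 :: "'a set" and ev1 :: "'h::complex_hilbert_space \<Rightarrow> 'a \<Rightarrow> complex"
    and \<Omega>2 :: "'b set" and ev2 :: "'k::complex_hilbert_space \<Rightarrow> 'b \<Rightarrow> complex"
    and S :: "'h \<Rightarrow> 'h" and X :: "'k \<Rightarrow> 'h" and Y :: "'h \<Rightarrow> 'k" and R :: "'k \<Rightarrow> 'k"
    and \<alpha> :: real
  assumes "functional_hilbert_space \<Omega>1 ev1"
    and "functional_hilbert_space \<Omega>2 ev2"
    and "bounded_clinear S" and "bounded_clinear X"
    and "bounded_clinear Y" and "bounded_clinear R"
    and "0 \<le> \<alpha>" and "\<alpha> \<le> 1"
  shows "ber (\<Omega>1 \<times> \<Omega>2)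
      (direct_sum_kernel (reproducing_kernel ev1) (reproducing_kernel ev2))
      (block_operator S X Y R)
    \<le> 1/2 * ber \<Omega>2 (reproducing_kernel ev2) R + ber \<Omega>1 (reproducing_kernel ev1) S
      + 1/2 * sqrt (\<alpha>\<^sup>2 * (ber \<Omega>2 (reproducing_kernel ev2) R)\<^sup>2 + (onorm Y)\<^sup>2)
      + 1/2 * sqrt ((1 - \<alpha>)\<^sup>2 * (ber \<Omega>2 (reproducing_kernel ev2) R)\<^sup>2 + (onorm X)\<^sup>2)"
proof -
  let ?k1 = "reproducing_kernel ev1" and ?k2 = "reproducing_kernel ev2"
  interpret H1: functional_hilbert_space \<Omega>1 ev1 by fact
  interpret H2: functional_hilbert_space \<Omega>2 ev2 by fact
  have bl: "bounded_linear S" "bounded_linear X" "bounded_linear Y" "bounded_linear R"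
    using assms(3-6) by (simp_all add: bounded_clinear_def)
  show ?thesis
    unfolding ber_def[of "\<Omega>1 \<times> \<Omega>2"]
  proof (rule cSUP_least)
    show "\<Omega>1 \<times> \<Omega>2 \<noteq> {}" using H1.nonempty H2.nonempty by blast
  next
    fix l assume "l \<in> \<Omega>1 \<times> \<Omega>2"
    then obtain l1 l2 where l: "l = (l1, l2)" and l1: "l1 \<in> \<Omega>1" and l2: "l2 \<in> \<Omega>2" by blast
    define u where "u = normalized_kernel ?k1 l1"
    define v where "v = normalized_kernel ?k2 l2"
    obtain c s where cs: "0 \<le> c" "0 \<le> s" "c\<^sup>2 + s\<^sup>2 = 1"
      and k: "normalized_kernel (direct_sum_kernel ?k1 ?k2) l = (c *\<^sub>R u, s *\<^sub>R v)"
      unfolding l u_def v_def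
      using normalized_kernel_direct_sum[where ?k1.0 = ?k1 and ?k2.0 = ?k2,
          OF H1.kernel_nonzero[OF l1] H2.kernel_nonzero[OF l2]] .
    have unit: "norm u = 1" "norm v = 1"
      unfolding u_def v_def
      using H1.kernel_nonzero[OF l1] H2.kernel_nonzero[OF l2] by (simp_all add: norm_normalized_kernel)
    have Sb: "cmod (cinner (S u) u) \<le> ber \<Omega>1 ?k1 S"
      using cmod_berezin_symbol_le_ber[OF bl(1) H1.kernel_nonzero l1]
      by (simp add: berezin_symbol_def u_def)
    have Rb: "cmod (cinner (R v) v) \<le> ber \<Omega>2 ?k2 R"
      using cmod_berezin_symbol_le_ber[OF bl(4) H2.kernel_nonzero l2]
      by (simp add: berezin_symbol_def v_def)
    \<comment> \<open>The off-diagonal terms mix kernels of the two spaces and are not Berezin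
      symbols, so operator norms replace Berezin numbers here.\<close>
    have XYb: "cmod (cinner (X v) u + cinner (Y u) v) \<le> onorm X + onorm Y"
      by (intro norm_triangle_le add_mono cmod_cinner_unit_le_onorm bl unit)
    have "cmod (berezin_symbol (direct_sum_kernel ?k1 ?k2) (block_operator S X Y R) l)
        \<le> c\<^sup>2 * cmod (cinner (S u) u) + s\<^sup>2 * cmod (cinner (R v) v)
          + c * s * cmod (cinner (X v) u + cinner (Y u) v)"
      unfolding berezin_symbol_def k cinner_block_operator[OF bl]
      \<comment> \<open>Since c and s are nonnegative, the modulus of the cross coefficient is
        \<open>c * s\<close> itself.\<close>
      by (intro norm_triangle_le add_mono)
        (simp_all only: norm_mult norm_of_real, simp_all add: cs)
    also have "\<dots> \<le> c\<^sup>2 * ber \<Omega>1 ?k1 S + s\<^sup>2 * ber \<Omega>2 ?k2 R + c * s * (onorm X + onorm Y)"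
      using cs by (intro add_mono mult_left_mono Sb Rb XYb) simp_all
    \<comment> \<open>Only the weight of \<open>S\<close> is relaxed to 1. The weight of
      \<open>R\<close> stays exact, since its half-angle form yields both the summand with factor
      1/2 and the terms under the roots.\<close>
    also have "c\<^sup>2 * ber \<Omega>1 ?k1 S \<le> ber \<Omega>1 ?k1 S"
    proof (rule mult_left_le_one_le)
      show "0 \<le> ber \<Omega>1 ?k1 S" using norm_ge_zero Sb by (rule order_trans)
      show "c\<^sup>2 \<le> 1" using cs(3) zero_le_power2[of s] by linarith
    qed simp
    finally show "cmod (berezin_symbol (direct_sum_kernel ?k1 ?k2) (block_operator S X Y R) l)
      \<le> 1/2 * ber \<Omega>2 ?k2 R + ber \<Omega>1 ?k1 S
        + 1/2 * sqrt (\<alpha>\<^sup>2 * (ber \<Omega>2 ?k2 R)\<^sup>2 + (onorm Y)\<^sup>2)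
        + 1/2 * sqrt ((1 - \<alpha>)\<^sup>2 * (ber \<Omega>2 ?k2 R)\<^sup>2 + (onorm X)\<^sup>2)"
      using weighted_sum_le_sqrt[OF cs(3), of "ber \<Omega>2 ?k2 R" "onorm X" "onorm Y" \<alpha>] by linarith
  qed
qed

end
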